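(* Let $A$ be a monomial algebra whose 1-chain language $L_1(A)$ satisfies $L_1(A)\subset (X^+)^2$. Then $A$ is an automaton algebra if and only if $L_1(A)$ is a regular language. In this case, all chain languages $L_k(A)$ $(k\geq 0)$ are also regular.
   Context: $\mathbb{K}$ is any field, $X=\{x_1,\ldots,x_n\}$ is a finite set, $X^*$ is the free monoid of words on $X$, $|w|$ is the length of a word $w$, and $X^+=\{w\in X^*\mid |w|\ge 1\}$, so $(X^+)^2$ is the set of words of length at least $2$. $F=\mathbb{K}\langle X\rangle$ is the free associative algebra. A monomial ideal is a two-sided ideal $I$ of $F$ generated by words; it has a unique minimal monomial basis $L_1$, i.e. a generating set of words which is an antichain (no word of it is a subword of a different word of it). A monomial algebra is $A=F/I$ with $I$ a monomial ideal; $N(I)=X^*\setminus I$ is its set of normal words. $A$ is called an automaton (monomial) algebra when the language $L(I)=I\cap X^*$ is a regular language (in the usual sense of formal language theory). Chain languages $L_i=L_i(A)$: $L_0=X$, and $L_1$ is the minimal monomial basis of $I$. Each $w\in L_1$ is written $w=st$ with $s\in L_0$ its first letter (its prefix $0$-chain) and $t\in N(I)$ (its tail). Inductively, for $i\ge 1$, suppose each $w\in L_i$ is written $w=st$ with prefix $(i-1)$-chain $s\in L_{i-1}$ and tail $t\in N(I)$. Let $\bar L'_{i+1}$ be the set of pairs $(w,u)$ with $w=st\in L_i$, $u\in X^*$, such that there exist $w'\in L_1$ and $v\in X^*$ with $wu=vw'$, $|u|<|w'|$, $|v|\ge |s|$. Let $\bar L_{i+1}$ be the set of those $(w,u)\in\bar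 L'_{i+1}$ for which there is no $(w,u_1)\in\bar L'_{i+1}$ with $u_1$ a proper prefix of $u$. Then $L_{i+1}=\{wu\mid (w,u)\in\bar L_{i+1}\}$, where $wu$ has prefix $i$-chain $w$ and tail $u$. (These languages give the minimal graded free right $A$-module resolution $\cdots\to\mathbb{K}L_1\otimes A\to\mathbb{K}L_0\otimes A\to A\to\mathbb{K}\to 0$, so that $\mathrm{Tor}_i^A(\mathbb{K},\mathbb{K})\cong\mathbb{K}L_{i-1}$ as $X^*$-graded vector spaces, with $L_{-1}=\{1\}$.) *)

theory Defs
  imports "HOL-Algebra.QuotRing" "HOL-Library.Sublist"
begin

text \<open>
  Words over an alphabet \<open>X\<close> are the elements of \<^term>\<open>lists X\<close>. Subwords are contiguous:
  \<^const>\<open>sublist\<close>, not \<^const>\<open>subseq\<close>.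
\<close>

definition long_words :: "'a set \<Rightarrow> 'a list set" where
  "long_words X = {w \<in> lists X. 2 \<le> length w}"

text \<open>
  Regularity means recognition by a complete deterministic finite automaton over \<open>X\<close>. Up to
  renaming, its states are \<open>0, \<dots>, m - 1\<close>.
\<close>

definition regular_language :: "'a set \<Rightarrow> 'a list set \<Rightarrow> bool" where
  "regular_language X L \<longleftrightarrow>
    (\<exists>(m::nat) (\<delta> :: nat \<Rightarrow> 'a \<Rightarrow> nat) q0 Acc.
       q0 < m \<and> (\<forall>q<m. \<forall>x\<in>X. \<delta> q x < m) \<and> Acc \<subseteq> {..<m} \<and>
       L = {w \<in> lists X. foldl \<delta> q0 w \<in> Acc})"

text \<open>
  An element of the free associative algebra is the finitely supported function sending each word
  to its coefficient. The product is convolution along all factorizations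
  \<open>w = take i w @ drop i w\<close>.
\<close>

definition word_monomial :: "('k, 'm) ring_scheme \<Rightarrow> 'a list \<Rightarrow> ('a list \<Rightarrow> 'k)" where
  "word_monomial K w = (\<lambda>v. if v = w then \<one>\<^bsub>K\<^esub> else \<zero>\<^bsub>K\<^esub>)"

definition free_algebra :: "('k, 'm) ring_scheme \<Rightarrow> 'a set \<Rightarrow> ('a list \<Rightarrow> 'k) ring" where
  "free_algebra K X =
    \<lparr>carrier = {f. range f \<subseteq> carrier K \<and> finite {w. f w \<noteq> \<zero>\<^bsub>K\<^esub>} \<and> {w. f w \<noteq> \<zero>\<^bsub>K\<^esub>} \<subseteq> lists X},
     mult = (\<lambda>f g w. \<Oplus>\<^bsub>K\<^esub>i\<in>{..length w}. f (take i w) \<otimes>\<^bsub>K\<^esub> g (drop i w)),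
     one = word_monomial K [],
     zero = (\<lambda>w. \<zero>\<^bsub>K\<^esub>),
     add = (\<lambda>f g w. f w \<oplus>\<^bsub>K\<^esub> g w)\<rparr>"

definition generated_ideal ::
    "('k, 'm) ring_scheme \<Rightarrow> 'a set \<Rightarrow> 'a list set \<Rightarrow> ('a list \<Rightarrow> 'k) set" where
  "generated_ideal K X W = Idl\<^bsub>free_algebra K X\<^esub> (word_monomial K ` W)"

definition monomial_ideal ::
    "('k, 'm) ring_scheme \<Rightarrow> 'a set \<Rightarrow> ('a list \<Rightarrow> 'k) set \<Rightarrow> bool" where
  "monomial_ideal K X I \<longleftrightarrow> (\<exists>W \<subseteq> lists X. I = generated_ideal K X W)"

definition ideal_language ::
    "('k, 'm) ring_scheme \<Rightarrow> 'a set \<Rightarrow> ('a list \<Rightarrow> 'k) set \<Rightarrow> 'a list set" where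
  "ideal_language K X I = {w \<in> lists X. word_monomial K w \<in> I}"

text \<open>
  Only the ring structure of the quotient is recorded. The ideal can be recovered from the quotient
  record as its zero element, so the existential quantifier leaves no choice of \<open>I\<close>.
\<close>

definition automaton_algebra ::
    "('k, 'm) ring_scheme \<Rightarrow> 'a set \<Rightarrow> ('a list \<Rightarrow> 'k) set ring \<Rightarrow> bool" where
  "automaton_algebra K X A \<longleftrightarrow>
    (\<exists>I. monomial_ideal K X I \<and> A = free_algebra K X Quot I \<and>
         regular_language X (ideal_language K X I))"

definition subword_antichain :: "'a list set \<Rightarrow> bool" where
  "subword_antichain B \<longleftrightarrow> (\<forall>u\<in>B. \<forall>v\<in>B. sublist u v \<longrightarrow> u = v)"

definition minimal_monomial_basis ::
    "('k, 'm) ring_scheme \<Rightarrow> 'a set \<Rightarrow> ('a list \<Rightarrow> 'k) set \<Rightarrow> 'a list set" where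
  "minimal_monomial_basis K X I =
    (THE B. B \<subseteq> lists X \<and> subword_antichain B \<and> generated_ideal K X B = I)"

text \<open>
  A chain is kept together with its decomposition \<open>(s, t)\<close> into prefix chain \<open>s\<close> and tail \<open>t\<close>.
  Given the decomposed \<open>i\<close>-chains \<open>D\<close> and the minimal basis \<open>B\<close>, \<open>extension_pairs X B D\<close> is the
  set \<open>L'\<close> of all pairs \<open>(w, u)\<close> with \<open>w = s @ t\<close> an \<open>i\<close>-chain satisfying the overlap condition,
  and \<open>minimal_pairs\<close> then discards those whose tail is not shortest possible.
\<close>

definition extension_pairs ::
    "'a set \<Rightarrow> 'a list set \<Rightarrow> ('a list \<times> 'a list) set \<Rightarrow> ('a list \<times> 'a list) set" where
  "extension_pairs X B D =
    {(w, u) | w u s t. (s, t) \<in> D \<and> w = s @ t \<and> u \<in> lists X \<and>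
       (\<exists>w'\<in>B. \<exists>v\<in>lists X. w @ u = v @ w' \<and> length u < length w' \<and> length s \<le> length v)}"

definition minimal_pairs :: "('a list \<times> 'a list) set \<Rightarrow> ('a list \<times> 'a list) set" where
  "minimal_pairs P = {(w, u) \<in> P. \<not> (\<exists>u1. strict_prefix u1 u \<and> (w, u1) \<in> P)}"

text \<open>
  \<open>chain_pairs X B i\<close> consists of the decomposed \<open>(i + 1)\<close>-chains; note the shift, due to
  \<open>0\<close>-chains having no decomposition. In a \<open>1\<close>-chain the prefix is the first letter.
\<close>

primrec chain_pairs :: "'a set \<Rightarrow> 'a list set \<Rightarrow> nat \<Rightarrow> ('a list \<times> 'a list) set" where
  "chain_pairs X B 0 = {([x], t) | x t. x \<in> X \<and> x # t \<in> B}"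
| "chain_pairs X B (Suc i) = minimal_pairs (extension_pairs X B (chain_pairs X B i))"

fun chains :: "'a set \<Rightarrow> 'a list set \<Rightarrow> nat \<Rightarrow> 'a list set" where
  "chains X B 0 = {[x] | x. x \<in> X}"
| "chains X B (Suc 0) = B"
| "chains X B (Suc (Suc i)) = {w @ u | w u. (w, u) \<in> chain_pairs X B (Suc i)}"

definition chain_language ::
    "('k, 'm) ring_scheme \<Rightarrow> 'a set \<Rightarrow> ('a list \<Rightarrow> 'k) set \<Rightarrow> nat \<Rightarrow> 'a list set" where
  "chain_language K X I = chains X (minimal_monomial_basis K X I)"

end

theory Submission
  imports Defs
begin

text \<open>
  The zero element of the quotient by a monomial ideal \<open>I\<close> is \<open>I\<close>, so being an automaton algebra is
  a property of the language \<open>L\<close> of words in \<open>I\<close> (\<open>automaton_algebra_iff\<close>). Since \<open>I\<close> is contained in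
  the set of all elements supported on words with a factor in a generating set, \<open>L\<close> is the set of
  words having a factor in the minimal basis \<open>B\<close>, and \<open>B\<close> is the set of words of \<open>L\<close> that are minimal
  for the factor order (\<open>minimal_monomial_basis_properties\<close>). Writing \<open>\<Sigma>\<close> for the alphabet, this
  reads \<open>L = \<Sigma>\<^sup>* B \<Sigma>\<^sup>*\<close> and \<open>B = L - (L \<Sigma>\<^sup>+ \<union> \<Sigma>\<^sup>+ L)\<close>, so each of the two languages is regular if
  the other one is, by the usual closure properties. These are derived from the Myhill--Nerode
  criterion that a language is regular if and only if it has finitely many residuals.

  For the higher chain languages, the point is that the extensions of a chain \<open>s @ t\<close> depend only on
  the set of residuals of \<open>B\<close> by nonempty suffixes of the tail \<open>t\<close>. Regard this set as the state of
  \<open>t\<close>. There are finitely many states, the tails in a given state form a regular language, and the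
  words that may follow a tail in state \<open>N\<close> are those that are prefix-minimal in the union of \<open>N\<close>
  (\<open>chain_pairs_Suc_iff\<close>). Because the chains of each length form a prefix code, a chain has only one
  tail, and induction on the length shows that the chains whose tail is in a given state form a
  regular language (\<open>regular_chains_in_state\<close>). A chain language is a finite union of these.
\<close>

section \<open>Regular languages through residuals\<close>

definition residual :: "'a set \<Rightarrow> 'a list set \<Rightarrow> 'a list \<Rightarrow> 'a list set" where
  "residual X L u = {v \<in> lists X. u @ v \<in> L}"

definition conc :: "'a list set \<Rightarrow> 'a list set \<Rightarrow> 'a list set" where
  "conc L M = {u @ v | u v. u \<in> L \<and> v \<in> M}"

lemma concI: "u \<in> L \<Longrightarrow> v \<in> M \<Longrightarrow> u @ v \<in> conc L M"
  by (auto simp: conc_def)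

lemma concE:
  assumes "w \<in> conc L M"
  obtains u v where "w = u @ v" "u \<in> L" "v \<in> M"
  using assms by (auto simp: conc_def)

lemma conc_lists:
  assumes "L \<subseteq> lists X" "M \<subseteq> lists X"
  shows "conc L M \<subseteq> lists X"
proof
  fix w assume "w \<in> conc L M"
  then obtain u v where "w = u @ v" "u \<in> lists X" "v \<in> lists X"
    using assms by (blast elim: concE)
  then show "w \<in> lists X" by simp
qed

lemma residual_residual:
  "v \<in> lists X \<Longrightarrow> residual X (residual X L u) v = residual X L (u @ v)"
  by (auto simp: residual_def)

lemma foldl_state_less:
  assumes "\<forall>q<m. \<forall>x\<in>X. \<delta> q x < (m::nat)" "q < m" "w \<in> lists X"
  shows "foldl \<delta> q w < m"
  using assms(2,3) by (induction w arbitrary: q) (auto simp: assms(1))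

text \<open>
  The Myhill--Nerode criterion. A residual depends only on the state reached, which gives one
  direction. Conversely the residuals are themselves the states of an automaton: reading \<open>x\<close> leads
  from \<open>R\<close> to its residual by \<open>[x]\<close>, and \<open>R\<close> accepts if it contains the empty word.
\<close>

lemma regular_language_iff_finite_residuals:
  "regular_language X L \<longleftrightarrow> L \<subseteq> lists X \<and> finite (residual X L ` lists X)"
proof
  assume "regular_language X L"
  then obtain m :: nat and \<delta> q0 Acc where
    q0: "q0 < m" and step: "\<forall>q<m. \<forall>x\<in>X. \<delta> q x < m" and
    L: "L = {w \<in> lists X. foldl \<delta> q0 w \<in> Acc}"
    unfolding regular_language_def by blast
  let ?R = "\<lambda>q. {v \<in> lists X. foldl \<delta> q v \<in> Acc}"
  have "residual X L ` lists X \<subseteq> ?R ` {..<m}"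
  proof
    fix R assume "R \<in> residual X L ` lists X"
    then obtain u where u: "u \<in> lists X" "R = residual X L u" by blast
    have "R = ?R (foldl \<delta> q0 u)"
      using u by (auto simp: residual_def L)
    moreover have "foldl \<delta> q0 u < m"
      using foldl_state_less[OF step q0] u(1) by blast
    ultimately show "R \<in> ?R ` {..<m}" by blast
  qed
  then show "L \<subseteq> lists X \<and> finite (residual X L ` lists X)"
    using L finite_surj[OF finite_lessThan] by blast
next
  assume "L \<subseteq> lists X \<and> finite (residual X L ` lists X)"
  then have sub: "L \<subseteq> lists X" and fin: "finite (residual X L ` lists X)" (is "finite ?Q")
    by auto
  obtain num :: "'a list set \<Rightarrow> nat" and m where
    num: "num ` ?Q = {i. i < m}" "inj_on num ?Q"
    using finite_imp_nat_seg_image_inj_on[OF fin]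
    by (metis finite_imp_inj_to_nat_seg[OF fin])
  \<comment> \<open>The injection \<open>num\<close> only renames residuals, because states have to be natural numbers.\<close>
  define \<delta> where "\<delta> q x = num (residual X (inv_into ?Q num q) [x])" for q x
  let ?state = "\<lambda>u. num (residual X L u)"
  have state: "?state u < m" if "u \<in> lists X" for u
    using num(1) that by blast
  have step: "\<delta> (?state u) x = ?state (u @ [x])" if "u \<in> lists X" "x \<in> X" for u x
    using num(2) that by (simp add: \<delta>_def residual_residual)
  have run: "foldl \<delta> (?state []) w = ?state w" if "w \<in> lists X" for w
    using that by (induction w rule: rev_induct) (auto simp: step)
  have mem: "w \<in> L \<longleftrightarrow> [] \<in> residual X L w" for w
    by (simp add: residual_def)
  let ?Acc = "?state ` L"
  have "L = {w \<in> lists X. foldl \<delta> (?state []) w \<in> ?Acc}"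
  proof (intro equalityI subsetI)
    fix w assume "w \<in> L"
    then show "w \<in> {w \<in> lists X. foldl \<delta> (?state []) w \<in> ?Acc}"
      using sub run[of w] by blast
  next
    fix w assume "w \<in> {w \<in> lists X. foldl \<delta> (?state []) w \<in> ?Acc}"
    then have w: "w \<in> lists X" and "foldl \<delta> (?state []) w \<in> ?Acc"
      by blast+
    then have "?state w \<in> ?Acc"
      by (simp only: run)
    then obtain v where v: "v \<in> L" "?state w = ?state v" by blast
    then have "residual X L w = residual X L v"
      using num(2) w sub unfolding inj_on_def by blast
    then show "w \<in> L"
      using v mem by simp
  qed
  moreover have "\<forall>q<m. \<forall>x\<in>X. \<delta> q x < m"
  proof (intro allI impI ballI)
    fix q x assume "q < m" "x \<in> X"
    then obtain u where "u \<in> lists X" "q = ?state u"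
      using num(1) by (metis (no_types, lifting) imageE mem_Collect_eq)
    then show "\<delta> q x < m"
      using step state \<open>x \<in> X\<close> by simp
  qed
  moreover have "?Acc \<subseteq> {..<m}"
    using state sub by blast
  moreover have "?state [] < m"
    by (simp add: state)
  ultimately show "regular_language X L"
    unfolding regular_language_def by blast
qed

lemma regular_language_subset: "regular_language X L \<Longrightarrow> L \<subseteq> lists X"
  by (simp add: regular_language_iff_finite_residuals)

text \<open>
  Most of the closure properties below rest on this rule, since the residuals of the new
  language are functions of the finitely many residuals of the old ones.
\<close>

lemma regular_languageI:
  assumes "L \<subseteq> lists X" "finite S" "\<And>u. u \<in> lists X \<Longrightarrow> residual X L u \<in> S"
  shows "regular_language X L"
  using assms finite_subset[of "residual X L ` lists X" S]
  by (auto simp: regular_language_iff_finite_residuals)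

lemma finite_residuals:
  "regular_language X L \<Longrightarrow> finite (residual X L ` lists X)"
  by (simp add: regular_language_iff_finite_residuals)

lemma regular_lists: "regular_language X (lists X)"
  by (rule regular_languageI[where S = "{lists X}"]) (auto simp: residual_def)

lemma regular_singleton:
  assumes "w \<in> lists X"
  shows "regular_language X {w}"
proof (rule regular_languageI)
  show "finite (insert {} ((\<lambda>v. {v}) ` set (suffixes w)))"
    by simp
  show "residual X {w} u \<in> insert {} ((\<lambda>v. {v}) ` set (suffixes w))" if "u \<in> lists X" for u
  proof (cases "prefix u w")
    case True
    then obtain v where "w = u @ v"
      by (auto simp: prefix_def)
    then show ?thesis
      using assms by (auto simp: residual_def suffix_def)
  next
    case False
    then show ?thesis
      by (auto simp: residual_def prefix_def)
  qed
qed (use assms in auto)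

lemma regular_Diff:
  assumes "regular_language X L" "regular_language X M"
  shows "regular_language X (L - M)"
proof (rule regular_languageI)
  show "finite ((\<lambda>(R, S). R - S) ` (residual X L ` lists X \<times> residual X M ` lists X))"
    using assms by (simp add: finite_residuals)
  show "residual X (L - M) u \<in>
      (\<lambda>(R, S). R - S) ` (residual X L ` lists X \<times> residual X M ` lists X)"
    if "u \<in> lists X" for u
    by (rule image_eqI[where x = "(residual X L u, residual X M u)"])
      (use that in \<open>auto simp: residual_def\<close>)
qed (use regular_language_subset[OF assms(1)] in auto)

lemma regular_Int:
  assumes "regular_language X L" "regular_language X M"
  shows "regular_language X (L \<inter> M)"
proof -
  have "L \<inter> M = L - (L - M)" by blast
  then show ?thesis
    using assms by (metis regular_Diff)
qed

lemma regular_Un: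
  assumes "regular_language X L" "regular_language X M"
  shows "regular_language X (L \<union> M)"
proof -
  have "L \<union> M = lists X - ((lists X - L) - M)"
    using assms[THEN regular_language_subset] by blast
  then show ?thesis
    using assms by (simp add: regular_Diff regular_lists)
qed

lemma regular_UN:
  assumes "finite J" "\<And>j. j \<in> J \<Longrightarrow> regular_language X (L j)"
  shows "regular_language X (\<Union>j\<in>J. L j)"
  using assms
proof (induction J rule: finite_induct)
  case empty
  have "regular_language X (lists X - lists X)"
    by (intro regular_Diff regular_lists)
  then show ?case by simp
qed (simp add: regular_Un)

lemma regular_residual:
  assumes "regular_language X L" "u \<in> lists X"
  shows "regular_language X (residual X L u)"
proof (rule regular_languageI)
  show "residual X (residual X L u) v \<in> residual X L ` lists X" if "v \<in> lists X" for v
    using that assms(2) by (simp add: residual_residual)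
qed (use assms finite_residuals in \<open>auto simp: residual_def\<close>)

text \<open>
  Reading \<open>u\<close> in \<open>LM\<close> either stops inside the first factor, or the first factor is a prefix of
  \<open>u\<close> and what remains is to be completed in \<open>M\<close>.
\<close>

lemma regular_conc:
  assumes L: "regular_language X L" and M: "regular_language X M"
  shows "regular_language X (conc L M)"
proof (rule regular_languageI)
  let ?QL = "residual X L ` lists X" and ?QM = "residual X M ` lists X"
  let ?f = "\<lambda>(R, S). conc R M \<union> \<Union>S"
  show "conc L M \<subseteq> lists X"
    using assms[THEN regular_language_subset] by (rule conc_lists)
  show "finite (?f ` (?QL \<times> Pow ?QM))"
    using assms by (simp add: finite_residuals)
  fix u assume u: "u \<in> lists X"
  let ?S = "{residual X M u2 | u1 u2. u = u1 @ u2 \<and> u1 \<in> L}"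
  have "residual X (conc L M) u = conc (residual X L u) M \<union> \<Union>?S"
  proof (intro equalityI subsetI)
    fix v assume "v \<in> residual X (conc L M) u"
    then obtain y z where v: "v \<in> lists X" and yz: "u @ v = y @ z" "y \<in> L" "z \<in> M"
      by (auto simp: residual_def conc_def)
    from yz(1) consider d where "y = u @ d" "v = d @ z" | d where "u = y @ d" "z = d @ v"
      by (auto simp: append_eq_append_conv2)
    then show "v \<in> conc (residual X L u) M \<union> \<Union>?S"
    proof cases
      case 1
      then show ?thesis using yz v by (auto simp: residual_def conc_def)
    next
      case 2
      then have "v \<in> residual X M d" "residual X M d \<in> ?S"
        using yz v by (auto simp: residual_def)
      then show ?thesis by blast
    qed
  next
    fix v assume "v \<in> conc (residual X L u) M \<union> \<Union>?S"
    then show "v \<in> residual X (conc L M) u"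
    proof
      assume "v \<in> conc (residual X L u) M"
      then obtain y z where "v = y @ z" "y \<in> lists X" "u @ y \<in> L" "z \<in> M"
        by (auto simp: residual_def conc_def)
      then show ?thesis
        using concI[of "u @ y" L z M] subsetD[OF regular_language_subset[OF M]]
        by (simp add: residual_def)
    next
      assume "v \<in> \<Union>?S"
      then obtain u1 u2 where "u = u1 @ u2" "u1 \<in> L" "v \<in> lists X" "u2 @ v \<in> M"
        by (auto simp: residual_def)
      then show ?thesis
        using concI[of u1 L "u2 @ v" M] by (simp add: residual_def)
    qed
  qed
  moreover have "?S \<subseteq> ?QM"
    using u by auto
  ultimately show "residual X (conc L M) u \<in> ?f ` (?QL \<times> Pow ?QM)"
    using u by (intro image_eqI[where x = "(residual X L u, ?S)"]) auto
qed

definition nonempty_words :: "'a set \<Rightarrow> 'a list set" where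
  "nonempty_words X = lists X - {[]}"

lemma regular_nonempty_words: "regular_language X (nonempty_words X)"
  unfolding nonempty_words_def by (intro regular_Diff regular_lists regular_singleton) auto

definition prefix_minimal :: "'a list set \<Rightarrow> 'a list set" where
  "prefix_minimal U = {u \<in> U. \<not> (\<exists>v\<in>U. strict_prefix v u)}"

text \<open>
  A word fails to be prefix-minimal in \<open>U\<close> exactly if it is a word of \<open>U\<close> followed by a nonempty
  word.
\<close>

lemma regular_prefix_minimal:
  assumes "regular_language X U"
  shows "regular_language X (prefix_minimal U)"
proof -
  have "prefix_minimal U = U - conc U (nonempty_words X)"
  proof -
    have "(\<exists>v\<in>U. strict_prefix v u) \<longleftrightarrow> u \<in> conc U (nonempty_words X)" if "u \<in> U" for u
    proof
      assume "\<exists>v\<in>U. strict_prefix v u"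
      then obtain v z where "v \<in> U" "u = v @ z" "z \<noteq> []"
        by (auto simp: strict_prefix_def prefix_def)
      moreover have "u \<in> lists X"
        using that regular_language_subset[OF assms] by blast
      ultimately show "u \<in> conc U (nonempty_words X)"
        by (auto simp: nonempty_words_def intro!: concI)
    next
      assume "u \<in> conc U (nonempty_words X)"
      then obtain v z where "u = v @ z" "v \<in> U" "z \<noteq> []"
        unfolding nonempty_words_def conc_def by blast
      then show "\<exists>v\<in>U. strict_prefix v u"
        by (intro bexI[of _ v]) (auto simp: strict_prefix_def)
    qed
    then show ?thesis
      unfolding prefix_minimal_def by blast
  qed
  then show ?thesis
    using assms by (simp add: regular_Diff regular_conc regular_nonempty_words)
qed

section \<open>Words with a factor in a given set\<close>

definition minimal_words :: "'a list set \<Rightarrow> 'a list set" where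
  "minimal_words L = {w \<in> L. \<forall>v\<in>L. sublist v w \<longrightarrow> v = w}"

definition factor_closure :: "'a set \<Rightarrow> 'a list set \<Rightarrow> 'a list set" where
  "factor_closure X B = {w \<in> lists X. \<exists>b\<in>B. sublist b w}"

lemma exists_minimal_factor:
  "w \<in> L \<Longrightarrow> \<exists>b \<in> minimal_words L. sublist b w"
proof (induction w rule: length_induct)
  case (1 w)
  show ?case
  proof (cases "w \<in> minimal_words L")
    case False
    then obtain v where v: "v \<in> L" "sublist v w" "v \<noteq> w"
      using 1 by (auto simp: minimal_words_def)
    then have "length v < length w"
      using sublist_length_le[OF v(2)] by (auto simp: sublist_def)
    then show ?thesis
      using 1 v by (meson sublist_order.order_trans)
  qed auto
qed

lemma antichain_minimal_words: "subword_antichain (minimal_words L)"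
  by (auto simp: subword_antichain_def minimal_words_def)

text \<open>
  A minimal word must equal any factor of it that lies in \<open>B\<close>, and a word of an antichain \<open>B\<close> has no
  other factor with a factor in \<open>B\<close>. This gives both the uniqueness of the minimal basis and the way
  back from the ideal to the basis.
\<close>

lemma minimal_words_factor_closure:
  assumes "B \<subseteq> lists X" "subword_antichain B"
  shows "minimal_words (factor_closure X B) = B"
proof (intro equalityI subsetI)
  fix w assume w: "w \<in> minimal_words (factor_closure X B)"
  then obtain b where "b \<in> B" "sublist b w"
    by (auto simp: minimal_words_def factor_closure_def)
  then show "w \<in> B"
    using w assms(1) sublist_order.order_refl[of b]
    unfolding minimal_words_def factor_closure_def by blast
next
  fix w assume w: "w \<in> B"
  show "w \<in> minimal_words (factor_closure X B)"
    unfolding minimal_words_def factor_closure_def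
  proof (intro CollectI conjI ballI impI)
    show "w \<in> lists X" "\<exists>b\<in>B. sublist b w" using w assms(1) by auto
    fix v assume v: "v \<in> {w \<in> lists X. \<exists>b\<in>B. sublist b w}" "sublist v w"
    then obtain b where b: "b \<in> B" "sublist b v" by blast
    then have "b = w"
      using assms(2) w v(2) unfolding subword_antichain_def by (meson sublist_order.order_trans)
    then show "v = w"
      using b(2) v(2) by (simp add: \<open>b = w\<close> sublist_order.dual_order.antisym)
  qed
qed

lemma regular_factor_closure:
  assumes "regular_language X B"
  shows "regular_language X (factor_closure X B)"
proof -
  have "factor_closure X B = conc (lists X) (conc B (lists X))"
  proof (intro equalityI subsetI)
    fix w assume "w \<in> factor_closure X B"
    then obtain p b q where "w = p @ b @ q" "b \<in> B" "w \<in> lists X"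
      unfolding factor_closure_def sublist_def by blast
    then show "w \<in> conc (lists X) (conc B (lists X))"
      by (simp add: concI)
  next
    fix w assume w: "w \<in> conc (lists X) (conc B (lists X))"
    then obtain p b q where "w = p @ b @ q" "b \<in> B"
      by (metis concE)
    moreover have "w \<in> lists X"
      using w regular_conc[OF regular_lists regular_conc[OF assms regular_lists]]
      by (blast dest: regular_language_subset)
    ultimately show "w \<in> factor_closure X B"
      by (auto simp: factor_closure_def sublist_def)
  qed
  then show ?thesis
    using assms by (simp add: regular_conc regular_lists)
qed

text \<open>
  A set \<open>L\<close> of words that is closed under adding letters on either side loses exactly the
  non-minimal words when the words of \<open>L\<close> with an additional nonempty word on the left or on the
  right are removed: a proper factor \<open>v\<close> of \<open>p @ v @ q\<close> can be enlarged to \<open>p @ v\<close> or \<open>v @ q\<close>.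
\<close>

lemma regular_minimal_words_factor_closure:
  assumes "regular_language X (factor_closure X B)"
  shows "regular_language X (minimal_words (factor_closure X B))"
proof -
  let ?L = "factor_closure X B" and ?P = "nonempty_words X"
  have ext: "p @ v @ q \<in> ?L" if "v \<in> ?L" "p \<in> lists X" "q \<in> lists X" for p v q
  proof -
    obtain b where "b \<in> B" "sublist b v" "v \<in> lists X"
      using \<open>v \<in> ?L\<close> by (auto simp: factor_closure_def)
    moreover have "sublist v (p @ v @ q)"
      by (auto simp: sublist_def)
    ultimately show ?thesis
      using that(2,3) sublist_order.order_trans[of b v "p @ v @ q"]
      unfolding factor_closure_def by auto
  qed
  have "minimal_words ?L = ?L - (conc ?L ?P \<union> conc ?P ?L)"
  proof (intro equalityI subsetI)
    fix w assume "w \<in> minimal_words ?L"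
    then have w: "w \<in> ?L" and min: "\<And>v. v \<in> ?L \<Longrightarrow> sublist v w \<Longrightarrow> v = w"
      by (auto simp: minimal_words_def)
    have "w \<notin> conc ?L ?P"
    proof
      assume "w \<in> conc ?L ?P"
      then obtain v z where "w = v @ z" "v \<in> ?L" "z \<noteq> []"
        unfolding conc_def nonempty_words_def by blast
      then show False using min[of v] by simp
    qed
    moreover have "w \<notin> conc ?P ?L"
    proof
      assume "w \<in> conc ?P ?L"
      then obtain v z where "w = z @ v" "v \<in> ?L" "z \<noteq> []"
        unfolding conc_def nonempty_words_def by blast
      then show False using min[of v] by simp
    qed
    ultimately show "w \<in> ?L - (conc ?L ?P \<union> conc ?P ?L)"
      using w by blast
  next
    fix w assume w: "w \<in> ?L - (conc ?L ?P \<union> conc ?P ?L)"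
    have "v = w" if v: "v \<in> ?L" "sublist v w" for v
    proof -
      obtain p q where pq: "w = p @ v @ q" using v(2) by (auto simp: sublist_def)
      then have X: "p \<in> lists X" "q \<in> lists X"
        using w by (auto simp: factor_closure_def)
      have "p @ v \<in> ?L" "v @ q \<in> ?L"
        using ext[of v p "[]"] ext[of v "[]" q] X v(1) by simp_all
      then have "q \<noteq> [] \<Longrightarrow> w \<in> conc ?L ?P" "p \<noteq> [] \<Longrightarrow> w \<in> conc ?P ?L"
        using X pq concI[of "p @ v" ?L q ?P] concI[of p ?P "v @ q" ?L]
        unfolding nonempty_words_def by simp_all
      then have "p = []" "q = []"
        using w by blast+
      then show ?thesis
        using pq by simp
    qed
    then show "w \<in> minimal_words ?L"
      using w by (auto simp: minimal_words_def)
  qed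
  then show ?thesis
    using assms by (simp add: regular_Diff regular_Un regular_conc regular_nonempty_words)
qed

section \<open>Chains\<close>

text \<open>
  Which words \<open>u\<close> may follow a chain with tail \<open>t\<close> is decided by the residuals of \<open>B\<close> by the
  nonempty suffixes \<open>y\<close> of \<open>t\<close>: the obstruction that is completed by \<open>u\<close> has to begin inside \<open>t\<close>.
  If \<open>B\<close> is regular, this set of residuals takes only finitely many values.
\<close>

definition tail_state :: "'a set \<Rightarrow> 'a list set \<Rightarrow> 'a list \<Rightarrow> 'a list set set" where
  "tail_state X B t = {residual X B y | y. y \<noteq> [] \<and> suffix y t}"

lemma tail_state_subset:
  "t \<in> lists X \<Longrightarrow> tail_state X B t \<subseteq> residual X B ` lists X"
  by (auto simp: tail_state_def suffix_def)

text \<open>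
  The state after reading \<open>u @ v\<close> depends on \<open>u\<close> only through the state after \<open>u\<close>. This makes the
  set of tails in a given state regular.
\<close>

lemma tail_state_append:
  assumes "v \<in> lists X"
  shows "tail_state X B (u @ v) = (\<lambda>R. residual X R v) ` tail_state X B u \<union> tail_state X B v"
proof (intro equalityI subsetI)
  fix R assume "R \<in> tail_state X B (u @ v)"
  then obtain y where y: "R = residual X B y" "y \<noteq> []" "suffix y (u @ v)"
    by (auto simp: tail_state_def)
  then consider y' where "y = y' @ v" "suffix y' u" "y' \<noteq> []" | "suffix y v"
    by (metis suffix_append append_Nil suffix_order.refl)
  then show "R \<in> (\<lambda>R. residual X R v) ` tail_state X B u \<union> tail_state X B v"
    by cases (use y assms in \<open>auto simp: tail_state_def residual_residual[symmetric]\<close>)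
next
  fix R assume "R \<in> (\<lambda>R. residual X R v) ` tail_state X B u \<union> tail_state X B v"
  then show "R \<in> tail_state X B (u @ v)"
  proof
    assume "R \<in> (\<lambda>R. residual X R v) ` tail_state X B u"
    then obtain y where "y \<noteq> []" "suffix y u" "R = residual X B (y @ v)"
      unfolding tail_state_def using residual_residual[OF assms] by blast
    then show ?thesis
      unfolding tail_state_def by (intro CollectI exI[of _ "y @ v"]) auto
  next
    assume "R \<in> tail_state X B v"
    then show ?thesis
      unfolding tail_state_def by (auto intro: suffix_appendI)
  qed
qed

definition tails_in_state :: "'a set \<Rightarrow> 'a list set \<Rightarrow> 'a list set set \<Rightarrow> 'a list set" where
  "tails_in_state X B M = {t \<in> lists X. tail_state X B t = M}"

lemma regular_tails_in_state:
  assumes "regular_language X B"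
  shows "regular_language X (tails_in_state X B M)"
proof (rule regular_languageI)
  let ?f = "\<lambda>N. {v \<in> lists X. (\<lambda>R. residual X R v) ` N \<union> tail_state X B v = M}"
  show "finite (?f ` Pow (residual X B ` lists X))"
    using assms by (simp add: finite_residuals)
  show "residual X (tails_in_state X B M) u \<in> ?f ` Pow (residual X B ` lists X)"
    if "u \<in> lists X" for u
  proof (rule image_eqI)
    show "residual X (tails_in_state X B M) u = ?f (tail_state X B u)"
    proof -
      have "v \<in> residual X (tails_in_state X B M) u \<longleftrightarrow> v \<in> ?f (tail_state X B u)" for v
      proof -
        have "v \<in> residual X (tails_in_state X B M) u \<longleftrightarrow> v \<in> lists X \<and> u @ v \<in> tails_in_state X B M"
          by (simp add: residual_def)
        then show ?thesis
          using that tail_state_append[of v X B u]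
          by (cases "v \<in> lists X") (simp_all add: tails_in_state_def)
      qed
      then show ?thesis by blast
    qed
    show "tail_state X B u \<in> Pow (residual X B ` lists X)"
      using tail_state_subset[OF that] by blast
  qed
qed (auto simp: tails_in_state_def)

lemma Union_tail_state:
  "\<Union>(tail_state X B t) = {u \<in> lists X. \<exists>y. y \<noteq> [] \<and> suffix y t \<and> y @ u \<in> B}"
  by (auto simp: tail_state_def residual_def)

text \<open>
  In \<open>w @ u = v @ w'\<close> the two length conditions say that \<open>w'\<close> begins strictly before \<open>u\<close> and not
  inside \<open>s\<close>. So \<open>w' = y @ u\<close> for a nonempty suffix \<open>y\<close> of \<open>t\<close>.
\<close>

lemma extension_pairs_iff:
  assumes B: "B \<subseteq> lists X" and D: "\<And>s t. (s, t) \<in> D \<Longrightarrow> s \<in> lists X \<and> t \<in> lists X"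
  shows "(w, u) \<in> extension_pairs X B D \<longleftrightarrow>
    (\<exists>s t. (s, t) \<in> D \<and> w = s @ t \<and> u \<in> \<Union>(tail_state X B t))"
proof
  assume "(w, u) \<in> extension_pairs X B D"
  then obtain s t w' v where st: "(s, t) \<in> D" "w = s @ t" and u: "u \<in> lists X" and
    w': "w' \<in> B" "w @ u = v @ w'" "length u < length w'" "length s \<le> length v"
    unfolding extension_pairs_def by blast
  obtain y where y: "w' = y @ u" "w = v @ y"
    using w'(2,3) by (auto simp: append_eq_append_conv2)
  moreover obtain t1 where "t = t1 @ y"
    using w'(4) st(2) y(2) by (auto simp: append_eq_append_conv2)
  ultimately have "u \<in> \<Union>(tail_state X B t)"
    using w' u by (auto simp: Union_tail_state suffix_def)
  then show "\<exists>s t. (s, t) \<in> D \<and> w = s @ t \<and> u \<in> \<Union>(tail_state X B t)"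
    using st by blast
next
  assume "\<exists>s t. (s, t) \<in> D \<and> w = s @ t \<and> u \<in> \<Union>(tail_state X B t)"
  then obtain s t1 y where st: "(s, t1 @ y) \<in> D" "w = s @ t1 @ y" and
    u: "u \<in> lists X" "y \<noteq> []" "y @ u \<in> B"
    by (auto simp: Union_tail_state suffix_def)
  have "w @ u = (s @ t1) @ y @ u \<and> length u < length (y @ u) \<and> length s \<le> length (s @ t1)"
    using st u by simp
  moreover have "s @ t1 \<in> lists X"
    using D[OF st(1)] by simp
  ultimately show "(w, u) \<in> extension_pairs X B D"
    unfolding extension_pairs_def using st u by blast
qed

lemma chain_pairs_lists:
  assumes "B \<subseteq> lists X"
  shows "(s, t) \<in> chain_pairs X B i \<Longrightarrow> s \<in> lists X \<and> t \<in> lists X"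
proof (induction i arbitrary: s t)
  case 0
  then show ?case using assms by auto
next
  case (Suc i)
  then have "(s, t) \<in> extension_pairs X B (chain_pairs X B i)"
    by (simp add: minimal_pairs_def)
  then obtain p q where "(p, q) \<in> chain_pairs X B i" "s = p @ q" "t \<in> lists X"
    unfolding extension_pairs_def by blast
  then show ?case
    using Suc.IH by (metis append_in_lists_conv)
qed

text \<open>
  For \<open>1\<close>-chains this is the antichain property. Two comparable longer chains have comparable prefix chains, which agree by induction, and then
  comparable tails, which agree because tails are chosen shortest. In particular a chain determines
  its tail, so the state of the tail is a function of the chain.
\<close>

lemma chain_pairs_prefix_free:
  assumes "subword_antichain B"
  shows "(s, t) \<in> chain_pairs X B i \<Longrightarrow> (s', t') \<in> chain_pairs X B i \<Longrightarrow>
    prefix (s @ t) (s' @ t') \<Longrightarrow> s = s' \<and> t = t'"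
proof (induction i arbitrary: s t s' t')
  case 0
  then obtain x x' where x: "s = [x]" "s' = [x']" and "s @ t \<in> B" "s' @ t' \<in> B"
    by auto
  then have "s @ t = s' @ t'"
    using assms prefix_imp_sublist[OF 0(3)] unfolding subword_antichain_def by blast
  then show ?case
    using x by simp
next
  case (Suc i)
  let ?P = "extension_pairs X B (chain_pairs X B i)"
  have ext: "\<exists>p q. (p, q) \<in> chain_pairs X B i \<and> a = p @ q"
    if "(a, b) \<in> chain_pairs X B (Suc i)" for a b
    using that by (auto simp: minimal_pairs_def extension_pairs_def)
  obtain p q p' q' where pq: "(p, q) \<in> chain_pairs X B i" "s = p @ q"
    "(p', q') \<in> chain_pairs X B i" "s' = p' @ q'"
    using ext Suc.prems(1,2) by metis
  have "prefix s (s' @ t')"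
    using Suc.prems(3) by (rule append_prefixD)
  then have "prefix s s' \<or> prefix s' s"
    by (rule prefix_same_cases) simp
  then have "s = s'"
    using Suc.IH[OF pq(1,3)] Suc.IH[OF pq(3,1)] pq(2,4) by auto
  moreover from this have "prefix t t'"
    using Suc.prems(3) by simp
  moreover have "(s, t) \<in> ?P" "(s', t') \<in> ?P"
    "\<not> (\<exists>u. strict_prefix u t' \<and> (s', u) \<in> ?P)"
    using Suc.prems(1,2) by (auto simp only: chain_pairs.simps minimal_pairs_def)
  ultimately show ?case
    by (auto simp only: strict_prefix_def)
qed

lemma chain_pairs_Suc_iff:
  assumes B: "B \<subseteq> lists X" "subword_antichain B"
  shows "(w, u) \<in> chain_pairs X B (Suc i) \<longleftrightarrow>
    (\<exists>s t. (s, t) \<in> chain_pairs X B i \<and> w = s @ t \<and> u \<in> prefix_minimal (\<Union>(tail_state X B t)))"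
proof -
  let ?E = "extension_pairs X B (chain_pairs X B i)"
  have E: "(s @ t, v) \<in> ?E \<longleftrightarrow> v \<in> \<Union>(tail_state X B t)" if "(s, t) \<in> chain_pairs X B i" for s t v
  proof -
    have "s' = s \<and> t' = t" if "(s', t') \<in> chain_pairs X B i" "s @ t = s' @ t'" for s' t'
      using chain_pairs_prefix_free[OF B(2) \<open>(s, t) \<in> _\<close> that(1)] that(2) by auto
    then have "(\<exists>s' t'. (s', t') \<in> chain_pairs X B i \<and> s @ t = s' @ t' \<and>
        v \<in> \<Union>(tail_state X B t')) \<longleftrightarrow> v \<in> \<Union>(tail_state X B t)"
      using that by metis
    then show ?thesis
      using extension_pairs_iff[OF B(1), of "chain_pairs X B i"] chain_pairs_lists[OF B(1)] by simp
  qed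
  have Suc: "(w, u) \<in> chain_pairs X B (Suc i) \<longleftrightarrow>
      (w, u) \<in> ?E \<and> \<not> (\<exists>v. strict_prefix v u \<and> (w, v) \<in> ?E)" for w u
    by (simp add: minimal_pairs_def)
  have "(s @ t, u) \<in> chain_pairs X B (Suc i) \<longleftrightarrow>
      u \<in> prefix_minimal (\<Union>(tail_state X B t))" if "(s, t) \<in> chain_pairs X B i" for s t u
  proof -
    define U where "U = \<Union>(tail_state X B t)"
    have "(s @ t, v) \<in> ?E \<longleftrightarrow> v \<in> U" for v
      unfolding U_def using E[OF that] .
    then show ?thesis
      unfolding U_def[symmetric] prefix_minimal_def Suc by (simp add: conj_commute Bex_def)
  qed
  moreover have "\<exists>s t. (s, t) \<in> chain_pairs X B i \<and> w = s @ t"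
    if "(w, u) \<in> chain_pairs X B (Suc i)"
    using that unfolding Suc extension_pairs_def by blast
  ultimately show ?thesis by metis
qed

definition chains_in_state ::
    "'a set \<Rightarrow> 'a list set \<Rightarrow> nat \<Rightarrow> 'a list set set \<Rightarrow> 'a list set" where
  "chains_in_state X B i M = {s @ t | s t. (s, t) \<in> chain_pairs X B i \<and> tail_state X B t = M}"

text \<open>
  Beyond the \<open>1\<close>-chains, a chain in state \<open>M\<close> is a chain of the previous level, in some state \<open>N\<close>, followed by a tail that is
  prefix-minimal in the union of \<open>N\<close> and itself leads to state \<open>M\<close>. There are finitely many states
  \<open>N\<close>, so this is a finite union of concatenations of regular languages.
\<close>

lemma regular_chains_in_state:
  assumes "finite X" and B: "regular_language X B" "subword_antichain B"
  shows "regular_language X (chains_in_state X B i M)"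
proof (induction i arbitrary: M)
  case 0
  have "chains_in_state X B 0 M =
      (\<Union>x\<in>X. conc {[x]} (residual X B [x] \<inter> tails_in_state X B M))"
  proof (intro equalityI subsetI)
    fix w assume "w \<in> chains_in_state X B 0 M"
    then obtain x t where xt: "w = [x] @ t" "x \<in> X" "x # t \<in> B" "tail_state X B t = M"
      by (auto simp: chains_in_state_def)
    moreover have "t \<in> lists X"
      using xt(3) regular_language_subset[OF B(1)] by auto
    ultimately have "w \<in> conc {[x]} (residual X B [x] \<inter> tails_in_state X B M)"
      unfolding xt(1) by (intro concI) (auto simp: residual_def tails_in_state_def)
    then show "w \<in> (\<Union>x\<in>X. conc {[x]} (residual X B [x] \<inter> tails_in_state X B M))"
      using xt(2) by blast
  next
    fix w assume "w \<in> (\<Union>x\<in>X. conc {[x]} (residual X B [x] \<inter> tails_in_state X B M))"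
    then obtain x t where "x \<in> X" "w = [x] @ t" "x # t \<in> B" "tail_state X B t = M"
      by (auto simp: conc_def residual_def tails_in_state_def)
    then show "w \<in> chains_in_state X B 0 M"
      unfolding chains_in_state_def by (intro CollectI exI[of _ "[x]"] exI[of _ t]) simp
  qed
  then show ?case
    using assms by (simp add: regular_UN regular_conc regular_singleton regular_Int
        regular_residual regular_tails_in_state)
next
  case (Suc i)
  let ?S = "Pow (residual X B ` lists X)"
  have BX: "B \<subseteq> lists X"
    using B(1) by (rule regular_language_subset)
  have "chains_in_state X B (Suc i) M = (\<Union>N\<in>?S.
      conc (chains_in_state X B i N) (prefix_minimal (\<Union>N) \<inter> tails_in_state X B M))"
    (is "?L = ?R")
  proof (intro equalityI subsetI)
    fix w assume "w \<in> ?L"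
    then obtain s t u where stu: "(s, t) \<in> chain_pairs X B i" "w = (s @ t) @ u"
      "u \<in> prefix_minimal (\<Union>(tail_state X B t))" "tail_state X B u = M"
      unfolding chains_in_state_def chain_pairs_Suc_iff[OF BX B(2)] by blast
    have "u \<in> lists X"
      using stu(3) by (auto simp: prefix_minimal_def Union_tail_state)
    then have "w \<in> conc (chains_in_state X B i (tail_state X B t))
        (prefix_minimal (\<Union>(tail_state X B t)) \<inter> tails_in_state X B M)"
      unfolding stu(2)
      using stu by (intro concI) (auto simp: chains_in_state_def tails_in_state_def)
    moreover have "tail_state X B t \<in> ?S"
      using chain_pairs_lists[OF BX stu(1)] tail_state_subset[of t X B] by simp
    ultimately show "w \<in> ?R" by blast
  next
    fix w assume "w \<in> ?R"
    then obtain s t u where "(s, t) \<in> chain_pairs X B i" "w = (s @ t) @ u"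
      "u \<in> prefix_minimal (\<Union>(tail_state X B t))" "tail_state X B u = M"
      unfolding conc_def chains_in_state_def tails_in_state_def by blast
    then show "w \<in> ?L"
      unfolding chains_in_state_def chain_pairs_Suc_iff[OF BX B(2)] by blast
  qed
  moreover have "regular_language X (\<Union>N)" if "N \<in> ?S" for N
  proof -
    have "finite N" "\<And>R. R \<in> N \<Longrightarrow> regular_language X R"
      using that finite_subset[OF _ finite_residuals[OF B(1)]] regular_residual[OF B(1)] by auto
    then show ?thesis
      using regular_UN[of N X id] by simp
  qed
  moreover have "finite ?S"
    using finite_residuals[OF B(1)] by simp
  ultimately show ?case
    using Suc.IH regular_tails_in_state[OF B(1)]
    by (simp only:) (intro regular_UN regular_conc regular_Int regular_prefix_minimal)
qed

lemma regular_chains: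
  assumes "finite X" and B: "regular_language X B" "subword_antichain B"
  shows "regular_language X (chains X B k)"
proof -
  consider "k = 0" | "k = Suc 0" | i where "k = Suc (Suc i)"
    by (metis not0_implies_Suc)
  then show ?thesis
  proof cases
    case 1
    have "chains X B 0 = (\<Union>x\<in>X. {[x]})" by auto
    then show ?thesis
      using 1 assms(1) by (simp only:) (intro regular_UN regular_singleton, auto)
  next
    case 2
    then show ?thesis using B(1) by simp
  next
    case (3 i)
    let ?S = "Pow (residual X B ` lists X)"
    have "chains X B k = (\<Union>M\<in>?S. chains_in_state X B (Suc i) M)"
    proof -
      have "tail_state X B t \<in> ?S" if "(s, t) \<in> chain_pairs X B (Suc i)" for s t
        using chain_pairs_lists[OF regular_language_subset[OF B(1)] that] tail_state_subset[of t X B]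
        by simp
      then show ?thesis
        unfolding 3 chains.simps chains_in_state_def by blast
    qed
    then show ?thesis
      using assms finite_residuals[OF B(1)] by (simp add: regular_UN regular_chains_in_state)
  qed
qed

section \<open>The free algebra\<close>

context ring
begin

text \<open>
  The product of the free algebra. Taking it on arbitrary functions on words, which is possible
  because a word has only finitely many factorizations, lets \<open>\<lambda>v. f (x # v)\<close> take the place of \<open>f\<close>
  in the induction below without keeping track of supports.
\<close>

definition convolution :: "('x list \<Rightarrow> 'a) \<Rightarrow> ('x list \<Rightarrow> 'a) \<Rightarrow> 'x list \<Rightarrow> 'a" where
  "convolution f g w = (\<Oplus>i\<in>{..length w}. f (take i w) \<otimes> g (drop i w))"

lemma convolution_closed:
  assumes "range f \<subseteq> carrier R" "range g \<subseteq> carrier R"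
  shows "convolution f g w \<in> carrier R"
  unfolding convolution_def using assms by (intro finsum_closed) (auto simp: image_subset_iff)

lemma convolution_Nil:
  assumes "range f \<subseteq> carrier R" "range g \<subseteq> carrier R"
  shows "convolution f g [] = f [] \<otimes> g []"
  using assms by (simp add: convolution_def image_subset_iff)

text \<open>
  Splitting off the factorization with empty first part turns the product into a recursion on the
  word. Associativity then follows by induction on the word, with no exchange of double sums.
\<close>

lemma convolution_Cons:
  assumes "range f \<subseteq> carrier R" "range g \<subseteq> carrier R"
  shows "convolution f g (x # w) = f [] \<otimes> g (x # w) \<oplus> convolution (\<lambda>v. f (x # v)) g w"
proof -
  have "convolution f g (x # w)
      = (\<Oplus>i\<in>{..length w}. f (x # take i w) \<otimes> g (drop i w)) \<oplus> f [] \<otimes> g (x # w)"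
    using assms finsum_Suc2[of "\<lambda>i. f (take i (x # w)) \<otimes> g (drop i (x # w))" "length w"]
    by (simp add: convolution_def image_subset_iff)
  then show ?thesis
    using assms by (simp add: convolution_def a_comm image_subset_iff)
qed

lemma convolution_add_left:
  assumes "range f \<subseteq> carrier R" "range g \<subseteq> carrier R" "range h \<subseteq> carrier R"
  shows "convolution (\<lambda>v. f v \<oplus> g v) h w = convolution f h w \<oplus> convolution g h w"
proof -
  have "convolution (\<lambda>v. f v \<oplus> g v) h w = (\<Oplus>i\<in>{..length w}.
      f (take i w) \<otimes> h (drop i w) \<oplus> g (take i w) \<otimes> h (drop i w))"
    unfolding convolution_def using assms by (intro finsum_cong') (auto simp: l_distr image_subset_iff)
  then show ?thesis
    using assms by (simp add: convolution_def finsum_addf image_subset_iff)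
qed

lemma convolution_add_right:
  assumes "range f \<subseteq> carrier R" "range g \<subseteq> carrier R" "range h \<subseteq> carrier R"
  shows "convolution h (\<lambda>v. f v \<oplus> g v) w = convolution h f w \<oplus> convolution h g w"
proof -
  have "convolution h (\<lambda>v. f v \<oplus> g v) w = (\<Oplus>i\<in>{..length w}.
      h (take i w) \<otimes> f (drop i w) \<oplus> h (take i w) \<otimes> g (drop i w))"
    unfolding convolution_def using assms by (intro finsum_cong') (auto simp: r_distr image_subset_iff)
  then show ?thesis
    using assms by (simp add: convolution_def finsum_addf image_subset_iff)
qed

lemma convolution_scale_left:
  assumes "range f \<subseteq> carrier R" "range g \<subseteq> carrier R" "c \<in> carrier R"
  shows "convolution (\<lambda>v. c \<otimes> f v) g w = c \<otimes> convolution f g w"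
proof -
  have "convolution (\<lambda>v. c \<otimes> f v) g w
      = (\<Oplus>i\<in>{..length w}. c \<otimes> (f (take i w) \<otimes> g (drop i w)))"
    unfolding convolution_def using assms by (intro finsum_cong') (auto simp: m_assoc image_subset_iff)
  then show ?thesis
    using assms by (simp add: convolution_def finsum_rdistr image_subset_iff)
qed

lemma convolution_assoc:
  assumes "range f \<subseteq> carrier R" "range g \<subseteq> carrier R" "range h \<subseteq> carrier R"
  shows "convolution (convolution f g) h w = convolution f (convolution g h) w"
  using assms
proof (induction w arbitrary: f g)
  case Nil
  then show ?case
    by (simp add: convolution_def image_subset_iff m_assoc)
next
  case (Cons x w)
  let ?f = "\<lambda>v. f (x # v)" and ?g = "\<lambda>v. g (x # v)"
  have shifted: "range ?f \<subseteq> carrier R" "range ?g \<subseteq> carrier R"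
    using Cons.prems by auto
  have ranges: "range ?f \<subseteq> carrier R" "range ?g \<subseteq> carrier R"
    "range (convolution f g) \<subseteq> carrier R" "range (convolution g h) \<subseteq> carrier R"
    "range (convolution ?f g) \<subseteq> carrier R" "range (\<lambda>v. f [] \<otimes> ?g v) \<subseteq> carrier R"
    using shifted Cons.prems(1) convolution_closed[OF Cons.prems(1,2)]
      convolution_closed[OF Cons.prems(2,3)] convolution_closed[OF shifted(1) Cons.prems(2)]
    by (auto simp: image_subset_iff)
  have mem: "f [] \<in> carrier R" "g [] \<in> carrier R" "h (x # w) \<in> carrier R"
    using Cons.prems by auto
  have "convolution (convolution f g) h (x # w) = (f [] \<otimes> g []) \<otimes> h (x # w)
      \<oplus> convolution (\<lambda>v. convolution f g (x # v)) h w"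
    using convolution_Cons[OF ranges(3) Cons.prems(3)] convolution_Nil[OF Cons.prems(1,2)] by simp
  also have "convolution (\<lambda>v. convolution f g (x # v)) h w =
      convolution (\<lambda>v. f [] \<otimes> ?g v \<oplus> convolution ?f g v) h w"
    by (subst convolution_Cons[OF Cons.prems(1,2)]) simp
  also have "\<dots> = f [] \<otimes> convolution ?g h w \<oplus> convolution ?f (convolution g h) w"
    using convolution_add_left[OF ranges(6,5) Cons.prems(3)]
      convolution_scale_left[OF ranges(2) Cons.prems(3) mem(1)]
      Cons.IH[OF ranges(1) Cons.prems(2,3)] by simp
  also have "(f [] \<otimes> g []) \<otimes> h (x # w) \<oplus> \<dots> =
      f [] \<otimes> convolution g h (x # w) \<oplus> convolution ?f (convolution g h) w"
    using convolution_Cons[OF Cons.prems(2,3), of x w] mem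
      convolution_closed[OF ranges(2) Cons.prems(3), of w]
      convolution_closed[OF ranges(1,4), of w]
    by (simp add: r_distr m_assoc a_assoc)
  also have "\<dots> = convolution f (convolution g h) (x # w)"
    using convolution_Cons[OF Cons.prems(1) ranges(4)] by simp
  finally show ?case .
qed

text \<open>
  This bounds the support of a product, and it makes the functions supported on words with a factor in \<open>W\<close> into an ideal.
\<close>

lemma convolution_nonzero:
  assumes "convolution f g w \<noteq> \<zero>" "range f \<subseteq> carrier R" "range g \<subseteq> carrier R"
  obtains u v where "w = u @ v" "f u \<noteq> \<zero>" "g v \<noteq> \<zero>"
proof -
  have "\<exists>i\<in>{..length w}. f (take i w) \<otimes> g (drop i w) \<noteq> \<zero>"
    using assms(1) unfolding convolution_def by (meson add.finprod_one_eqI)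
  then obtain i where "f (take i w) \<otimes> g (drop i w) \<noteq> \<zero>" by blast
  then have "f (take i w) \<noteq> \<zero>" "g (drop i w) \<noteq> \<zero>"
    using assms(2,3) by (auto simp: image_subset_iff)
  then show thesis
    using that[of "take i w" "drop i w"] by simp
qed

lemma range_word_monomial: "range (word_monomial R u) \<subseteq> carrier R"
  by (auto simp: word_monomial_def)

lemma convolution_word_monomials:
  "convolution (word_monomial R u) (word_monomial R v) = word_monomial R (u @ v)"
proof
  fix w
  show "convolution (word_monomial R u) (word_monomial R v) w = word_monomial R (u @ v) w"
  proof (cases "w = u @ v")
    case True
    have "convolution (word_monomial R u) (word_monomial R v) w
        = (\<Oplus>i\<in>{..length w}. if length u = i then \<one> else \<zero>)"
      unfolding True convolution_def
    proof (intro finsum_cong')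
      fix i assume i: "i \<in> {..length (u @ v)}"
      have "take i (u @ v) = u \<and> drop i (u @ v) = v \<longleftrightarrow> length u = i"
        using i by (metis append_eq_conv_conj atMost_iff length_take min.absorb2)
      then show "word_monomial R u (take i (u @ v)) \<otimes> word_monomial R v (drop i (u @ v))
          = (if length u = i then \<one> else \<zero>)"
        by (auto simp: word_monomial_def)
    qed auto
    also have "\<dots> = \<one>"
      using finsum_singleton[of "length u" "{..length w}" "\<lambda>_. \<one>"] True by simp
    finally show ?thesis
      using True by (simp add: word_monomial_def)
  next
    case False
    then have "convolution (word_monomial R u) (word_monomial R v) w = \<zero>"
      using convolution_nonzero[OF _ range_word_monomial range_word_monomial, of u v w]
      by (metis (full_types) word_monomial_def)
    then show ?thesis
      using False by (simp add: word_monomial_def)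
  qed
qed

lemma convolution_one_left:
  assumes "range f \<subseteq> carrier R"
  shows "convolution (word_monomial R []) f w = f w"
proof -
  have "convolution (word_monomial R []) f w
      = (\<Oplus>i\<in>{..length w}. if 0 = i then f (drop i w) else \<zero>)"
    unfolding convolution_def using assms by (intro finsum_cong') (auto simp: word_monomial_def image_subset_iff)
  then show ?thesis
    using finsum_singleton[of 0 "{..length w}" "\<lambda>i. f (drop i w)"] assms
    by (simp add: image_subset_iff)
qed

lemma convolution_one_right:
  assumes "range f \<subseteq> carrier R"
  shows "convolution f (word_monomial R []) w = f w"
proof -
  have "convolution f (word_monomial R []) w
      = (\<Oplus>i\<in>{..length w}. if length w = i then f (take i w) else \<zero>)"
    unfolding convolution_def using assms by (intro finsum_cong') (auto simp: word_monomial_def image_subset_iff)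
  then show ?thesis
    using finsum_singleton[of "length w" "{..length w}" "\<lambda>i. f (take i w)"] assms
    by (simp add: image_subset_iff)
qed

lemma free_algebra_carrier_iff:
  "f \<in> carrier (free_algebra R X) \<longleftrightarrow>
    range f \<subseteq> carrier R \<and> finite {w. f w \<noteq> \<zero>} \<and> {w. f w \<noteq> \<zero>} \<subseteq> lists X"
  by (simp add: free_algebra_def)

lemma free_algebra_ops:
  "f \<otimes>\<^bsub>free_algebra R X\<^esub> g = convolution f g"
  "\<one>\<^bsub>free_algebra R X\<^esub> = word_monomial R []"
  "\<zero>\<^bsub>free_algebra R X\<^esub> = (\<lambda>w. \<zero>)"
  "f \<oplus>\<^bsub>free_algebra R X\<^esub> g = (\<lambda>w. f w \<oplus> g w)"
  by (simp_all add: free_algebra_def fun_eq_iff convolution_def)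

lemma word_monomial_carrier:
  "w \<in> lists X \<Longrightarrow> word_monomial R w \<in> carrier (free_algebra R X)"
  by (auto simp: free_algebra_carrier_iff word_monomial_def split: if_splits)

lemma word_monomials_carrier:
  "W \<subseteq> lists X \<Longrightarrow> word_monomial R ` W \<subseteq> carrier (free_algebra R X)"
  by (blast intro: word_monomial_carrier)

lemma free_algebra_uminus_carrier:
  assumes "f \<in> carrier (free_algebra R X)"
  shows "(\<lambda>w. \<ominus> f w) \<in> carrier (free_algebra R X)"
proof -
  have "{w. \<ominus> f w \<noteq> \<zero>} \<subseteq> {w. f w \<noteq> \<zero>}" by auto
  then show ?thesis
    using assms unfolding free_algebra_carrier_iff
    by (auto intro: finite_subset simp: image_subset_iff)
qed

lemma free_algebra_add_carrier:
  assumes "f \<in> carrier (free_algebra R X)" "g \<in> carrier (free_algebra R X)"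
  shows "(\<lambda>w. f w \<oplus> g w) \<in> carrier (free_algebra R X)"
proof -
  have "{w. f w \<oplus> g w \<noteq> \<zero>} \<subseteq> {w. f w \<noteq> \<zero>} \<union> {w. g w \<noteq> \<zero>}" by auto
  then show ?thesis
    using assms finite_subset[of "{w. f w \<oplus> g w \<noteq> \<zero>}" "{w. f w \<noteq> \<zero>} \<union> {w. g w \<noteq> \<zero>}"]
    unfolding free_algebra_carrier_iff by (simp add: image_subset_iff) blast
qed

lemma free_algebra_mult_carrier:
  assumes "f \<in> carrier (free_algebra R X)" "g \<in> carrier (free_algebra R X)"
  shows "convolution f g \<in> carrier (free_algebra R X)"
proof -
  have f: "range f \<subseteq> carrier R" "finite {w. f w \<noteq> \<zero>}" "{w. f w \<noteq> \<zero>} \<subseteq> lists X"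
    and g: "range g \<subseteq> carrier R" "finite {w. g w \<noteq> \<zero>}" "{w. g w \<noteq> \<zero>} \<subseteq> lists X"
    using assms unfolding free_algebra_carrier_iff by auto
  let ?P = "(\<lambda>(u, v). u @ v) ` ({w. f w \<noteq> \<zero>} \<times> {w. g w \<noteq> \<zero>})"
  have "{w. convolution f g w \<noteq> \<zero>} \<subseteq> ?P"
  proof
    fix w assume "w \<in> {w. convolution f g w \<noteq> \<zero>}"
    then obtain u v where "w = u @ v" "f u \<noteq> \<zero>" "g v \<noteq> \<zero>"
      using convolution_nonzero[OF _ f(1) g(1)] by blast
    then show "w \<in> ?P" by auto
  qed
  moreover have "finite ?P"
    using f(2) g(2) by simp
  moreover have "?P \<subseteq> lists X"
  proof
    fix w assume "w \<in> ?P"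
    then obtain u v where w: "w = u @ v" and "f u \<noteq> \<zero>" "g v \<noteq> \<zero>"
      by auto
    then have "u \<in> lists X" "v \<in> lists X"
      using f(3) g(3) by blast+
    then show "w \<in> lists X"
      unfolding w by simp
  qed
  moreover have "range (convolution f g) \<subseteq> carrier R"
    using convolution_closed[OF f(1) g(1)] by (rule image_subsetI)
  ultimately show ?thesis
    unfolding free_algebra_carrier_iff by (meson finite_subset subset_trans)
qed

lemma ring_free_algebra:
  fixes X :: "'x set"
  shows "ring (free_algebra R X)"
proof (rule ringI)
  have closed: "f w \<in> carrier R" if "f \<in> carrier (free_algebra R X)" for f :: "'x list \<Rightarrow> 'a" and w
    using that by (auto simp: free_algebra_carrier_iff)
  have range: "range f \<subseteq> carrier R" if "f \<in> carrier (free_algebra R X)" for f :: "'x list \<Rightarrow> 'a"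
    using that by (simp add: free_algebra_carrier_iff)
  show "abelian_group (free_algebra R X)"
  proof (rule abelian_groupI, unfold free_algebra_ops)
    show "\<exists>g\<in>carrier (free_algebra R X). (\<lambda>w. g w \<oplus> f w) = (\<lambda>w. \<zero>)"
      if "f \<in> carrier (free_algebra R X)" for f :: "'x list \<Rightarrow> 'a"
      using free_algebra_uminus_carrier[OF that] closed[OF that] by (auto simp: l_neg intro!: bexI)
  qed (simp_all add: free_algebra_add_carrier closed a_ac, simp add: free_algebra_carrier_iff)
  show "Group.monoid (free_algebra R X)"
  proof (rule monoidI, unfold free_algebra_ops)
    fix f g h :: "'x list \<Rightarrow> 'a"
    assume f: "f \<in> carrier (free_algebra R X)"
    show "convolution (word_monomial R []) f = f" "convolution f (word_monomial R []) = f"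
      using convolution_one_left[OF range[OF f]] convolution_one_right[OF range[OF f]] by auto
    assume g: "g \<in> carrier (free_algebra R X)"
    show "convolution f g \<in> carrier (free_algebra R X)"
      using f g by (rule free_algebra_mult_carrier)
    assume h: "h \<in> carrier (free_algebra R X)"
    show "convolution (convolution f g) h = convolution f (convolution g h)"
      by (rule ext) (rule convolution_assoc[OF f[THEN range] g[THEN range] h[THEN range]])
  qed (simp add: word_monomial_carrier)
  fix f g h :: "'x list \<Rightarrow> 'a"
  assume f: "f \<in> carrier (free_algebra R X)" and g: "g \<in> carrier (free_algebra R X)"
    and h: "h \<in> carrier (free_algebra R X)"
  show "(f \<oplus>\<^bsub>free_algebra R X\<^esub> g) \<otimes>\<^bsub>free_algebra R X\<^esub> h =
      f \<otimes>\<^bsub>free_algebra R X\<^esub> h \<oplus>\<^bsub>free_algebra R X\<^esub> g \<otimes>\<^bsub>free_algebra R X\<^esub> h"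
    unfolding free_algebra_ops
    by (rule ext) (rule convolution_add_left[OF f[THEN range] g[THEN range] h[THEN range]])
  show "h \<otimes>\<^bsub>free_algebra R X\<^esub> (f \<oplus>\<^bsub>free_algebra R X\<^esub> g) =
      h \<otimes>\<^bsub>free_algebra R X\<^esub> f \<oplus>\<^bsub>free_algebra R X\<^esub> h \<otimes>\<^bsub>free_algebra R X\<^esub> g"
    unfolding free_algebra_ops
    by (rule ext) (rule convolution_add_right[OF f[THEN range] g[THEN range] h[THEN range]])
qed

section \<open>Monomial ideals\<close>

definition factor_supported :: "'x set \<Rightarrow> 'x list set \<Rightarrow> ('x list \<Rightarrow> 'a) set" where
  "factor_supported X W =
    {f \<in> carrier (free_algebra R X). \<forall>w. f w \<noteq> \<zero> \<longrightarrow> (\<exists>b\<in>W. sublist b w)}"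

text \<open>
  This ideal is an upper bound for the ideal generated by \<open>W\<close>, so a monomial in the latter must
  have a factor in \<open>W\<close>.
\<close>

lemma ideal_factor_supported: "ideal (factor_supported X W) (free_algebra R X)"
proof (rule idealI[OF ring_free_algebra])
  interpret F: ring "free_algebra R X" by (rule ring_free_algebra)
  show "subgroup (factor_supported X W) (add_monoid (free_algebra R X))"
  proof (rule F.add.subgroupI)
    show "factor_supported X W \<subseteq> carrier (free_algebra R X)"
      by (auto simp: factor_supported_def)
    have "\<zero>\<^bsub>free_algebra R X\<^esub> \<in> factor_supported X W"
      using F.zero_closed by (simp add: factor_supported_def free_algebra_ops)
    then show "factor_supported X W \<noteq> {}" by blast
    show "\<ominus>\<^bsub>free_algebra R X\<^esub> f \<in> factor_supported X W" if "f \<in> factor_supported X W" for f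
    proof -
      have f: "f \<in> carrier (free_algebra R X)"
        using that by (simp add: factor_supported_def)
      have "\<ominus>\<^bsub>free_algebra R X\<^esub> f = (\<lambda>w. \<ominus> f w)"
      proof (rule F.minus_equality)
        show "(\<lambda>w. \<ominus> f w) \<oplus>\<^bsub>free_algebra R X\<^esub> f = \<zero>\<^bsub>free_algebra R X\<^esub>"
          using f by (auto simp: free_algebra_ops fun_eq_iff free_algebra_carrier_iff l_neg
              image_subset_iff)
      qed (use f free_algebra_uminus_carrier[OF f] in simp_all)
      moreover have "f w \<noteq> \<zero>" if "\<ominus> f w \<noteq> \<zero>" for w
        using that by auto
      ultimately show ?thesis
        using that free_algebra_uminus_carrier[OF f] by (simp add: factor_supported_def)
    qed
    fix f g assume f: "f \<in> factor_supported X W" and g: "g \<in> factor_supported X W"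
    have "\<exists>b\<in>W. sublist b w" if "f w \<oplus> g w \<noteq> \<zero>" for w
    proof -
      have "f w \<noteq> \<zero> \<or> g w \<noteq> \<zero>"
        using that by auto
      then show ?thesis
        using f g unfolding factor_supported_def by blast
    qed
    moreover have "(\<lambda>w. f w \<oplus> g w) \<in> carrier (free_algebra R X)"
      using f g by (simp add: factor_supported_def free_algebra_add_carrier)
    ultimately show "f \<oplus>\<^bsub>free_algebra R X\<^esub> g \<in> factor_supported X W"
      by (simp add: factor_supported_def free_algebra_ops)
  qed
  fix f g assume f: "f \<in> factor_supported X W" and g: "g \<in> carrier (free_algebra R X)"
  have ranges: "range f \<subseteq> carrier R" "range g \<subseteq> carrier R" and
    fF: "f \<in> carrier (free_algebra R X)" and
    W: "\<And>w. f w \<noteq> \<zero> \<Longrightarrow> \<exists>b\<in>W. sublist b w"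
    using f g by (auto simp: factor_supported_def free_algebra_carrier_iff)
  have "\<exists>b\<in>W. sublist b w" if nz: "convolution g f w \<noteq> \<zero>" for w
  proof -
    obtain u v where "w = u @ v" "f v \<noteq> \<zero>"
      using convolution_nonzero[OF nz ranges(2,1)] by blast
    then show ?thesis
      using W[of v] sublist_append_leftI[of v u] by (blast intro: sublist_order.order_trans)
  qed
  then show "g \<otimes>\<^bsub>free_algebra R X\<^esub> f \<in> factor_supported X W"
    using free_algebra_mult_carrier[OF g fF] by (simp add: factor_supported_def free_algebra_ops)
  have "\<exists>b\<in>W. sublist b w" if nz: "convolution f g w \<noteq> \<zero>" for w
  proof -
    obtain u v where "w = u @ v" "f u \<noteq> \<zero>"
      using convolution_nonzero[OF nz ranges] by blast
    then show ?thesis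
      using W[of u] sublist_append_rightI[of u v] by (blast intro: sublist_order.order_trans)
  qed
  then show "f \<otimes>\<^bsub>free_algebra R X\<^esub> g \<in> factor_supported X W"
    using free_algebra_mult_carrier[OF fF g] by (simp add: factor_supported_def free_algebra_ops)
qed

lemma ideal_generated_ideal:
  assumes "W \<subseteq> lists X"
  shows "ideal (generated_ideal R X W) (free_algebra R X)"
  unfolding generated_ideal_def using word_monomials_carrier[OF assms]
  by (rule ring.genideal_ideal[OF ring_free_algebra])

lemma ideal_word_monomial_sublist:
  assumes J: "ideal J (free_algebra R X)" and b: "word_monomial R b \<in> J"
    and w: "sublist b w" "w \<in> lists X"
  shows "word_monomial R w \<in> J"
proof -
  interpret J: ideal J "free_algebra R X" by (rule J)
  obtain p q where pq: "w = p @ b @ q"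
    using w(1) by (auto simp: sublist_def)
  then have "word_monomial R p \<in> carrier (free_algebra R X)"
    "word_monomial R q \<in> carrier (free_algebra R X)"
    using w(2) by (auto intro: word_monomial_carrier)
  then have "word_monomial R p \<otimes>\<^bsub>free_algebra R X\<^esub>
      (word_monomial R b \<otimes>\<^bsub>free_algebra R X\<^esub> word_monomial R q) \<in> J"
    using b by (intro J.I_l_closed J.I_r_closed)
  then show ?thesis
    by (simp add: free_algebra_ops convolution_word_monomials pq)
qed

lemma word_monomial_in_generated_ideal:
  assumes "W \<subseteq> lists X" "b \<in> W" "sublist b w" "w \<in> lists X"
  shows "word_monomial R w \<in> generated_ideal R X W"
proof (rule ideal_word_monomial_sublist[OF ideal_generated_ideal[OF assms(1)] _ assms(3,4)])
  show "word_monomial R b \<in> generated_ideal R X W"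
    unfolding generated_ideal_def using assms(2)
      ring.genideal_self[OF ring_free_algebra word_monomials_carrier[OF assms(1)]] by blast
qed

lemma ideal_language_generated_ideal:
  assumes "W \<subseteq> lists X" "\<one> \<noteq> \<zero>"
  shows "ideal_language R X (generated_ideal R X W) = factor_closure X W"
proof (intro equalityI subsetI)
  fix w assume "w \<in> ideal_language R X (generated_ideal R X W)"
  then have w: "w \<in> lists X" "word_monomial R w \<in> generated_ideal R X W"
    by (auto simp: ideal_language_def)
  have "word_monomial R ` W \<subseteq> factor_supported X W"
  proof (rule image_subsetI)
    fix u assume u: "u \<in> W"
    then have "\<exists>b\<in>W. sublist b v" if "word_monomial R u v \<noteq> \<zero>" for v
      using that by (auto simp: word_monomial_def split: if_splits)
    then show "word_monomial R u \<in> factor_supported X W"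
      using u word_monomials_carrier[OF assms(1)] unfolding factor_supported_def by blast
  qed
  then have "generated_ideal R X W \<subseteq> factor_supported X W"
    unfolding generated_ideal_def
    by (rule ring.genideal_minimal[OF ring_free_algebra ideal_factor_supported])
  then have "word_monomial R w w \<noteq> \<zero> \<longrightarrow> (\<exists>b\<in>W. sublist b w)"
    using w(2) unfolding factor_supported_def by blast
  then show "w \<in> factor_closure X W"
    using w(1) assms(2) by (simp add: factor_closure_def word_monomial_def)
next
  fix w assume "w \<in> factor_closure X W"
  then show "w \<in> ideal_language R X (generated_ideal R X W)"
    using word_monomial_in_generated_ideal[OF assms(1)]
    unfolding factor_closure_def ideal_language_def by blast
qed

lemma generated_ideal_mono_factors:
  assumes "W \<subseteq> factor_closure X V" "V \<subseteq> lists X"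
  shows "generated_ideal R X W \<subseteq> generated_ideal R X V"
proof -
  have "word_monomial R ` W \<subseteq> generated_ideal R X V"
    using assms(1) word_monomial_in_generated_ideal[OF assms(2)] unfolding factor_closure_def by blast
  then show ?thesis
    unfolding generated_ideal_def[of R X W]
    by (rule ring.genideal_minimal[OF ring_free_algebra ideal_generated_ideal[OF assms(2)]])
qed

lemma generated_ideal_minimal_words:
  assumes "W \<subseteq> lists X"
  shows "generated_ideal R X (minimal_words W) = generated_ideal R X W"
proof (rule equalityI; rule generated_ideal_mono_factors)
  show "W \<subseteq> factor_closure X (minimal_words W)"
    using assms exists_minimal_factor unfolding factor_closure_def by blast
qed (use assms in \<open>auto simp: factor_closure_def minimal_words_def\<close>)

text \<open>
  The antichain generating \<open>I\<close> can be read off from \<open>I\<close>, as the minimal words of its language.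
  So the definite description denotes it, and the words in \<open>I\<close> are those with a factor in it.
\<close>

lemma minimal_monomial_basis_properties:
  assumes "monomial_ideal R X I" "\<one> \<noteq> \<zero>"
  defines "B \<equiv> minimal_monomial_basis R X I"
  shows "B \<subseteq> lists X" "subword_antichain B" "ideal_language R X I = factor_closure X B"
proof -
  let ?basis = "\<lambda>B. B \<subseteq> lists X \<and> subword_antichain B \<and> generated_ideal R X B = I"
  obtain W where W: "W \<subseteq> lists X" "I = generated_ideal R X W"
    using assms(1) by (auto simp: monomial_ideal_def)
  have "minimal_words W \<subseteq> lists X"
    using W(1) unfolding minimal_words_def by blast
  then have "?basis (minimal_words W)"
    using antichain_minimal_words generated_ideal_minimal_words[OF W(1)] W(2) by simp
  moreover have unique: "C = minimal_words (ideal_language R X I)" if "?basis C" for C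
    using that ideal_language_generated_ideal[OF _ assms(2)] minimal_words_factor_closure by metis
  ultimately have "\<exists>!C. ?basis C" by metis
  then have "?basis B"
    unfolding B_def minimal_monomial_basis_def by (rule theI')
  then show "B \<subseteq> lists X" "subword_antichain B" "ideal_language R X I = factor_closure X B"
    using ideal_language_generated_ideal[OF _ assms(2)] by auto
qed

end

text \<open>
  The zero element of the quotient is the coset \<open>I\<close> itself, so equal quotients come from equal
  ideals.
\<close>

lemma automaton_algebra_iff:
  assumes "monomial_ideal K X I"
  shows "automaton_algebra K X (free_algebra K X Quot I) \<longleftrightarrow>
    regular_language X (ideal_language K X I)"
proof -
  have "J = I" if "free_algebra K X Quot I = free_algebra K X Quot J" for J
    using arg_cong[OF that, of zero] by (simp add: FactRing_def)
  then show ?thesis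
    using assms unfolding automaton_algebra_def by blast
qed

theorem corollary5p3:
  fixes K :: "('k, 'm) ring_scheme"
    and X :: "'a set"
    and I :: "('a list \<Rightarrow> 'k) set"
    and A :: "('a list \<Rightarrow> 'k) set ring"
  assumes "field K"
    and "finite X"
    and "monomial_ideal K X I"
    and "A = free_algebra K X Quot I"
    and "chain_language K X I 1 \<subseteq> long_words X"
  shows "(automaton_algebra K X A \<longleftrightarrow> regular_language X (chain_language K X I 1)) \<and>
         (automaton_algebra K X A \<longrightarrow> (\<forall>k. regular_language X (chain_language K X I k)))"
proof -
  interpret field K by fact
  let ?B = "minimal_monomial_basis K X I"
  note B = minimal_monomial_basis_properties[OF assms(3) one_not_zero]
  have "automaton_algebra K X A \<longleftrightarrow> regular_language X (factor_closure X ?B)"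
    using automaton_algebra_iff[OF assms(3)] assms(4) B(3) by simp
  also have "\<dots> \<longleftrightarrow> regular_language X ?B"
    using regular_factor_closure regular_minimal_words_factor_closure
      minimal_words_factor_closure[OF B(1,2)] by metis
  finally have "automaton_algebra K X A \<longleftrightarrow> regular_language X ?B" .
  then show ?thesis
    using regular_chains[OF assms(2) _ B(2)] by (simp add: chain_language_def)
qed

end
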